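(* Let $\phi:\mathbb{U}\to\mathbb{U}$ be analytic and let $\psi$ be analytic on $\mathbb{U}$ such that $W_{\psi,\phi}$ is bounded on $H^2(\mathbb{U})$. If $W_{\psi,\phi}$ is normal, then either $\psi\equiv 0$ or $\psi$ never vanishes on $\mathbb{U}$.
   Context: $\mathbb{U}$ is the open unit disc in $\mathbb{C}$. $H^2(\mathbb{U})$ is the Hardy space of analytic functions on $\mathbb{U}$ with square-summable Maclaurin coefficients, a Hilbert space with inner product $\langle f,g\rangle=\sum_{n\ge 0}\hat f(n)\overline{\hat g(n)}$, where $\hat f(n)$ are the Maclaurin coefficients. The weighted composition operator is $W_{\psi,\phi}f=\psi\cdot(f\circ\phi)$. *)

theory Defs
  imports "HOL-Complex_Analysis.Complex_Analysis"
begin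

abbreviation unit_disc :: "complex set" where
  "unit_disc \<equiv> ball 0 1"

definition maclaurin_coeff :: "(complex \<Rightarrow> complex) \<Rightarrow> nat \<Rightarrow> complex" where
  "maclaurin_coeff f n = fps_nth (fps_expansion f 0) n"

text \<open>
  A function on the disc is represented by the total function extending it by zero,
  so that equality in the space below is equality of HOL functions.
\<close>
definition hardy2 :: "(complex \<Rightarrow> complex) set" where
  "hardy2 = {f. f holomorphic_on unit_disc
              \<and> summable (\<lambda>n. (cmod (maclaurin_coeff f n))\<^sup>2)
              \<and> (\<forall>z. z \<notin> unit_disc \<longrightarrow> f z = 0)}"

definition hardy2_inner :: "(complex \<Rightarrow> complex) \<Rightarrow> (complex \<Rightarrow> complex) \<Rightarrow> complex" where
  "hardy2_inner f g = (\<Sum>n. maclaurin_coeff f n * cnj (maclaurin_coeff g n))"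

definition hardy2_norm :: "(complex \<Rightarrow> complex) \<Rightarrow> real" where
  "hardy2_norm f = sqrt (Re (hardy2_inner f f))"

definition weighted_comp ::
  "(complex \<Rightarrow> complex) \<Rightarrow> (complex \<Rightarrow> complex) \<Rightarrow> (complex \<Rightarrow> complex) \<Rightarrow> (complex \<Rightarrow> complex)" where
  "weighted_comp \<psi> \<phi> f = (\<lambda>z. if z \<in> unit_disc then \<psi> z * f (\<phi> z) else 0)"

text \<open>
  The operator notions below are meant for maps that are linear on \<^const>\<open>hardy2\<close>; their
  values outside \<^const>\<open>hardy2\<close> are irrelevant.
\<close>
definition hardy2_bounded ::
  "((complex \<Rightarrow> complex) \<Rightarrow> (complex \<Rightarrow> complex)) \<Rightarrow> bool" where
  "hardy2_bounded T \<longleftrightarrow>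
     (\<forall>f\<in>hardy2. T f \<in> hardy2) \<and>
     (\<exists>C. \<forall>f\<in>hardy2. hardy2_norm (T f) \<le> C * hardy2_norm f)"

text \<open>
  For a bounded linear operator \<open>T\<close> and \<open>g\<close> in \<^const>\<open>hardy2\<close>, the described function
  exists uniquely by the Riesz representation theorem.
\<close>
definition hardy2_adjoint ::
  "((complex \<Rightarrow> complex) \<Rightarrow> (complex \<Rightarrow> complex)) \<Rightarrow> (complex \<Rightarrow> complex) \<Rightarrow> (complex \<Rightarrow> complex)" where
  "hardy2_adjoint T g =
     (THE h. h \<in> hardy2 \<and> (\<forall>f\<in>hardy2. hardy2_inner (T f) g = hardy2_inner f h))"

definition hardy2_normal ::
  "((complex \<Rightarrow> complex) \<Rightarrow> (complex \<Rightarrow> complex)) \<Rightarrow> bool" where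
  "hardy2_normal T \<longleftrightarrow>
     (\<forall>f\<in>hardy2. T (hardy2_adjoint T f) = hardy2_adjoint T (T f))"

end

theory Submission
  imports Defs
begin

text \<open>
  Write \<open>T\<close> for the operator and suppose \<open>\<psi> w = 0\<close> with \<open>w\<close> in the disc. The adjoint maps the
  reproducing kernel \<open>K\<^sub>w\<close> to \<open>cnj (\<psi> w) K\<^bsub>\<phi> w\<^esub> = 0\<close>, so normality gives
  \<open>T\<^sup>* (T K\<^sub>w) = T (T\<^sup>* K\<^sub>w) = 0\<close> and therefore \<open>T K\<^sub>w = 0\<close>. As
  \<open>K\<^sub>w z = 1 / (1 - cnj w z)\<close> has no zeros in the disc, \<open>\<psi>\<close> vanishes identically.
\<close>

section \<open>Power series with square-summable coefficients\<close>

definition square_summable :: "(nat \<Rightarrow> complex) \<Rightarrow> bool" where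
  "square_summable a \<longleftrightarrow> summable (\<lambda>n. (cmod (a n))\<^sup>2)"

text \<open>Inverse of \<open>maclaurin_coeff\<close> on \<open>hardy2\<close>. The value 0 off the
  disc follows the convention of \<open>hardy2\<close>, so that identities hold between HOL
  functions and not only on the disc.\<close>

definition hardy_of :: "(nat \<Rightarrow> complex) \<Rightarrow> complex \<Rightarrow> complex" where
  "hardy_of a z = (if z \<in> unit_disc then (\<Sum>n. a n * z ^ n) else 0)"

lemma maclaurin_coeff_sums:
  assumes "f holomorphic_on unit_disc" "z \<in> unit_disc"
  shows "(\<lambda>n. maclaurin_coeff f n * z ^ n) sums f z"
  using holomorphic_power_series[OF assms]
  by (simp add: maclaurin_coeff_def fps_expansion_def)

text \<open>Uniqueness of power series: convergence at the real points of (0, 1) already forces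
  convergence radius at least 1, and agreement with \<open>f\<close> near 0 then makes
  \<open>a\<close> its expansion.\<close>

lemma power_series_holomorphic_coeff:
  assumes "\<And>z. z \<in> unit_disc \<Longrightarrow> (\<lambda>n. a n * z ^ n) sums f z"
  shows "f holomorphic_on unit_disc" "maclaurin_coeff f = a"
proof -
  show hol: "f holomorphic_on unit_disc"
    by (rule power_series_holomorphic[where a = a]) (use assms in simp)
  have "1 \<le> fps_conv_radius (Abs_fps a)"
    unfolding fps_conv_radius_def
  proof (rule conv_radius_geI_ex')
    fix r :: real assume "0 < r" "ereal r < 1"
    then show "summable (\<lambda>n. fps_nth (Abs_fps a) n * of_real r ^ n)"
      using assms[of "of_real r"] by (auto simp: sums_iff)
  qed
  moreover have "eventually (\<lambda>z. z \<in> unit_disc) (nhds (0::complex))"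
    by (rule eventually_nhds_in_open) auto
  then have "eventually (\<lambda>z. eval_fps (Abs_fps a) z = f z) (nhds 0)"
    by eventually_elim (use assms in \<open>simp add: eval_fps_def sums_iff\<close>)
  ultimately have "f has_fps_expansion Abs_fps a"
    unfolding has_fps_expansion_def by (auto intro: less_le_trans[of 0 "1::ereal"])
  then show "maclaurin_coeff f = a"
    by (auto simp: maclaurin_coeff_def fps_expansion_eqI)
qed

text \<open>Square-summable coefficients are bounded, so a geometric series dominates the power
  series at each point of the disc.\<close>

lemma square_summable_sums:
  assumes "square_summable a" "z \<in> unit_disc"
  shows "(\<lambda>n. a n * z ^ n) sums hardy_of a z"
proof -
  have "(\<lambda>n. (cmod (a n))\<^sup>2) \<longlonglongrightarrow> 0"
    using assms(1) unfolding square_summable_def by (rule summable_LIMSEQ_zero)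
  then obtain B where B: "\<And>n. (cmod (a n))\<^sup>2 \<le> B"
    using convergent_imp_Bseq[OF convergentI] by (fastforce simp: Bseq_def)
  \<comment> \<open>From x \<le> 2x \<le> x^2 + 1 for x \<ge> 0; this bounds \<open>a\<close>
    without taking a root of \<open>B\<close>.\<close>
  have "cmod (a n) \<le> B + 1" for n
  proof -
    have "cmod (a n) \<le> 2 * cmod (a n)" by simp
    also have "\<dots> \<le> (cmod (a n))\<^sup>2 + 1"
      using sum_squares_bound[of "cmod (a n)" 1] by simp
    finally show ?thesis
      using B[of n] by linarith
  qed
  then have "summable (\<lambda>n. a n * z ^ n)"
    using assms(2)
    by (intro summable_comparison_test[OF _ summable_mult[OF summable_geometric, of "cmod z" "B + 1"]])
       (auto intro!: exI[of _ 0] mult_right_mono simp: norm_mult norm_power)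
  then show ?thesis
    using assms(2) by (simp add: hardy_of_def summable_sums)
qed

lemma maclaurin_coeff_hardy_of:
  assumes "square_summable a"
  shows "maclaurin_coeff (hardy_of a) = a"
  by (rule power_series_holomorphic_coeff) (rule square_summable_sums[OF assms])

lemma hardy_of_in_hardy2:
  assumes "square_summable a"
  shows "hardy_of a \<in> hardy2"
  using power_series_holomorphic_coeff[of a "hardy_of a"] square_summable_sums[OF assms] assms
  by (auto simp: hardy2_def square_summable_def hardy_of_def)

lemma square_summable_maclaurin_coeff:
  "f \<in> hardy2 \<Longrightarrow> square_summable (maclaurin_coeff f)"
  by (simp add: hardy2_def square_summable_def)

lemma hardy_of_maclaurin_coeff:
  assumes "f \<in> hardy2"
  shows "hardy_of (maclaurin_coeff f) = f"
proof
  fix z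
  show "hardy_of (maclaurin_coeff f) z = f z"
    using assms maclaurin_coeff_sums[of f z] by (auto simp: hardy2_def hardy_of_def sums_iff)
qed

lemma square_summable_add_cmult:
  assumes "square_summable a" "square_summable b"
  shows "square_summable (\<lambda>n. a n + c * b n)"
  unfolding square_summable_def
proof (rule summable_comparison_test)
  show "summable (\<lambda>n. 2 * (cmod (a n))\<^sup>2 + 2 * (cmod c)\<^sup>2 * (cmod (b n))\<^sup>2)"
    using assms unfolding square_summable_def by (intro summable_add summable_mult)
  have "(cmod (a n + c * b n))\<^sup>2 \<le> 2 * (cmod (a n))\<^sup>2 + 2 * (cmod c)\<^sup>2 * (cmod (b n))\<^sup>2" for n
  proof -
    have "(cmod (a n + c * b n))\<^sup>2 \<le> (cmod (a n) + cmod c * cmod (b n))\<^sup>2"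
      by (intro power_mono norm_triangle_le) (auto simp: norm_mult)
    also have "\<dots> \<le> 2 * (cmod (a n))\<^sup>2 + 2 * (cmod c)\<^sup>2 * (cmod (b n))\<^sup>2"
      using sum_squares_bound[of "cmod (a n)" "cmod c * cmod (b n)"]
      by (simp add: power2_sum power_mult_distrib)
    finally show ?thesis .
  qed
  then show "\<exists>N. \<forall>n\<ge>N. norm ((cmod (a n + c * b n))\<^sup>2)
      \<le> 2 * (cmod (a n))\<^sup>2 + 2 * (cmod c)\<^sup>2 * (cmod (b n))\<^sup>2"
    by auto
qed

lemma hardy_of_add_cmult:
  assumes "square_summable a" "square_summable b"
  shows "hardy_of (\<lambda>n. a n + c * b n) = (\<lambda>z. hardy_of a z + c * hardy_of b z)"
proof
  fix z
  show "hardy_of (\<lambda>n. a n + c * b n) z = hardy_of a z + c * hardy_of b z"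
  proof (cases "z \<in> unit_disc")
    case True
    have "(\<lambda>n. a n * z ^ n + c * (b n * z ^ n)) sums (hardy_of a z + c * hardy_of b z)"
      using assms True by (intro sums_add sums_mult square_summable_sums)
    with True show ?thesis
      by (simp add: hardy_of_def sums_iff algebra_simps)
  qed (simp add: hardy_of_def)
qed

text \<open>Linear combinations are computed on coefficient sequences and carried back by
  \<open>hardy_of\<close>, whose coefficients are known.\<close>

lemma
  assumes "f \<in> hardy2" "g \<in> hardy2"
  shows hardy2_add_cmult: "(\<lambda>z. f z + c * g z) \<in> hardy2"
    and maclaurin_coeff_add_cmult: "maclaurin_coeff (\<lambda>z. f z + c * g z)
      = (\<lambda>n. maclaurin_coeff f n + c * maclaurin_coeff g n)"
proof -
  note ss = assms[THEN square_summable_maclaurin_coeff]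
  have eq: "(\<lambda>z. f z + c * g z) = hardy_of (\<lambda>n. maclaurin_coeff f n + c * maclaurin_coeff g n)"
    using hardy_of_add_cmult[OF ss] assms by (simp add: hardy_of_maclaurin_coeff)
  show "(\<lambda>z. f z + c * g z) \<in> hardy2"
    unfolding eq by (intro hardy_of_in_hardy2 square_summable_add_cmult ss)
  show "maclaurin_coeff (\<lambda>z. f z + c * g z) = (\<lambda>n. maclaurin_coeff f n + c * maclaurin_coeff g n)"
    unfolding eq by (intro maclaurin_coeff_hardy_of square_summable_add_cmult ss)
qed

lemma zero_in_hardy2: "(\<lambda>z. 0) \<in> hardy2"
  and maclaurin_coeff_zero: "maclaurin_coeff (\<lambda>z. 0) n = 0"
proof -
  have *: "maclaurin_coeff (\<lambda>z. 0) = (\<lambda>n. 0)"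
    by (rule power_series_holomorphic_coeff) simp
  then show "maclaurin_coeff (\<lambda>z. 0) n = 0" by simp
  show "(\<lambda>z. 0) \<in> hardy2" by (simp add: hardy2_def *)
qed

section \<open>The inner product\<close>

text \<open>The finite Cauchy-Schwarz inequality bounds the partial sums of absolute values
  uniformly in \<open>N\<close>; this one bound gives both absolute convergence and the inequality
  in the limit.\<close>

lemma square_summable_product:
  assumes "square_summable a" "square_summable b"
  shows "summable (\<lambda>n. a n * cnj (b n))"
    and "cmod (\<Sum>n. a n * cnj (b n)) \<le> sqrt (\<Sum>n. (cmod (a n))\<^sup>2) * sqrt (\<Sum>n. (cmod (b n))\<^sup>2)"
proof -
  have bound: "(\<Sum>n<N. cmod (a n * cnj (b n)))
      \<le> sqrt (\<Sum>n. (cmod (a n))\<^sup>2) * sqrt (\<Sum>n. (cmod (b n))\<^sup>2)" for N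
  proof -
    have "(\<Sum>n<N. cmod (a n * cnj (b n)))
        \<le> L2_set (\<lambda>n. cmod (a n)) {..<N} * L2_set (\<lambda>n. cmod (b n)) {..<N}"
      using L2_set_mult_ineq[of "\<lambda>n. cmod (a n)" "\<lambda>n. cmod (b n)" "{..<N}"]
      by (simp add: norm_mult)
    also have "\<dots> \<le> sqrt (\<Sum>n. (cmod (a n))\<^sup>2) * sqrt (\<Sum>n. (cmod (b n))\<^sup>2)"
      using assms unfolding L2_set_def square_summable_def
      by (intro mult_mono real_sqrt_le_mono sum_le_suminf)
         (auto intro!: sum_nonneg suminf_nonneg)
    finally show ?thesis .
  qed
  have s: "summable (\<lambda>n. cmod (a n * cnj (b n)))"
    by (rule summableI_nonneg_bounded[OF _ bound]) auto
  then show "summable (\<lambda>n. a n * cnj (b n))"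
    by (rule summable_norm_cancel)
  have "cmod (\<Sum>n. a n * cnj (b n)) \<le> (\<Sum>n. cmod (a n * cnj (b n)))"
    by (rule summable_norm[OF s])
  also have "\<dots> \<le> sqrt (\<Sum>n. (cmod (a n))\<^sup>2) * sqrt (\<Sum>n. (cmod (b n))\<^sup>2)"
    by (rule suminf_le_const[OF s bound])
  finally show "cmod (\<Sum>n. a n * cnj (b n))
    \<le> sqrt (\<Sum>n. (cmod (a n))\<^sup>2) * sqrt (\<Sum>n. (cmod (b n))\<^sup>2)" .
qed

lemma hardy2_inner_self:
  assumes "f \<in> hardy2"
  shows "hardy2_inner f f = of_real (\<Sum>n. (cmod (maclaurin_coeff f n))\<^sup>2)"
proof -
  have "(\<lambda>n. complex_of_real ((cmod (maclaurin_coeff f n))\<^sup>2))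
      sums of_real (\<Sum>n. (cmod (maclaurin_coeff f n))\<^sup>2)"
    using assms by (intro sums_of_real summable_sums) (simp add: hardy2_def)
  then show ?thesis
    by (simp add: hardy2_inner_def complex_norm_square[symmetric] sums_iff)
qed

lemma hardy2_norm_eq:
  "f \<in> hardy2 \<Longrightarrow> hardy2_norm f = sqrt (\<Sum>n. (cmod (maclaurin_coeff f n))\<^sup>2)"
  by (simp add: hardy2_norm_def hardy2_inner_self)

lemma hardy2_Cauchy_Schwarz:
  assumes "f \<in> hardy2" "g \<in> hardy2"
  shows "cmod (hardy2_inner f g) \<le> hardy2_norm f * hardy2_norm g"
  using square_summable_product(2)[OF assms[THEN square_summable_maclaurin_coeff]] assms
  by (simp add: hardy2_inner_def hardy2_norm_eq)

lemma hardy2_inner_add_cmult_left: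
  assumes "f \<in> hardy2" "g \<in> hardy2" "h \<in> hardy2"
  shows "hardy2_inner (\<lambda>z. f z + c * g z) h = hardy2_inner f h + c * hardy2_inner g h"
proof -
  note ss = assms[THEN square_summable_maclaurin_coeff]
  have "(\<lambda>n. maclaurin_coeff f n * cnj (maclaurin_coeff h n)
        + c * (maclaurin_coeff g n * cnj (maclaurin_coeff h n)))
      sums (hardy2_inner f h + c * hardy2_inner g h)"
    unfolding hardy2_inner_def
    by (intro sums_add sums_mult summable_sums square_summable_product ss)
  then show ?thesis
    unfolding hardy2_inner_def[of "\<lambda>z. f z + c * g z"]
    by (simp add: maclaurin_coeff_add_cmult assms sums_iff algebra_simps)
qed

lemma hardy2_inner_zero: "hardy2_inner (\<lambda>z. 0) g = 0" "hardy2_inner f (\<lambda>z. 0) = 0"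
  by (simp_all add: hardy2_inner_def maclaurin_coeff_zero)

lemma hardy2_inner_self_eq_0:
  assumes "f \<in> hardy2" "hardy2_inner f f = 0"
  shows "f = (\<lambda>z. 0)"
proof -
  have "(\<Sum>n. (cmod (maclaurin_coeff f n))\<^sup>2) = 0"
    using assms by (simp only: hardy2_inner_self of_real_eq_0_iff)
  then have "\<forall>n. maclaurin_coeff f n = 0"
    using assms(1) suminf_eq_zero_iff[of "\<lambda>n. (cmod (maclaurin_coeff f n))\<^sup>2"]
    by (auto simp: hardy2_def)
  then have "hardy_of (maclaurin_coeff f) = (\<lambda>z. 0)"
    by (auto simp: hardy_of_def)
  then show ?thesis
    using hardy_of_maclaurin_coeff[OF assms(1)] by simp
qed

text \<open>Testing against the difference of \<open>g\<close> and \<open>h\<close> shows that this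
  difference has norm 0. This supplies the uniqueness behind the description in
  \<open>hardy2_adjoint\<close>.\<close>

lemma hardy2_inner_ext:
  assumes "g \<in> hardy2" "h \<in> hardy2"
    and "\<And>f. f \<in> hardy2 \<Longrightarrow> hardy2_inner f g = hardy2_inner f h"
  shows "g = h"
proof -
  define d where "d = (\<lambda>z. g z + (-1) * h z)"
  have d: "d \<in> hardy2"
    unfolding d_def by (intro hardy2_add_cmult assms)
  have coeff_d: "cnj (maclaurin_coeff d n) = cnj (maclaurin_coeff g n) - cnj (maclaurin_coeff h n)" for n
    unfolding d_def by (simp only: maclaurin_coeff_add_cmult assms) simp
  note ss = d[THEN square_summable_maclaurin_coeff] assms(1,2)[THEN square_summable_maclaurin_coeff]
  have "(\<lambda>n. maclaurin_coeff d n * cnj (maclaurin_coeff g n)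
        - maclaurin_coeff d n * cnj (maclaurin_coeff h n))
      sums (hardy2_inner d g - hardy2_inner d h)"
    unfolding hardy2_inner_def
    by (intro sums_diff summable_sums square_summable_product ss)
  then have "hardy2_inner d d = hardy2_inner d g - hardy2_inner d h"
    unfolding hardy2_inner_def[of d d]
    by (simp add: sums_iff coeff_d algebra_simps)
  also have "\<dots> = 0"
    using assms(3)[OF d] by simp
  finally have "d = (\<lambda>z. 0)"
    by (rule hardy2_inner_self_eq_0[OF d])
  then show "g = h"
    by (auto simp: d_def fun_eq_iff)
qed

section \<open>Riesz representation and the adjoint\<close>

lemma square_summable_finite: "square_summable (\<lambda>n. if n < N then a n else 0)"
  unfolding square_summable_def by (rule summable_finite[of "{..<N}"]) auto

lemma square_summable_unit: "square_summable (\<lambda>n. if n = k then 1 else 0)"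
  unfolding square_summable_def by (rule summable_finite[of "{k}"]) auto

text \<open>The values of \<open>L\<close> on monomials dictate the coefficients of
  \<open>h\<close>. Boundedness is used twice: on truncations of \<open>b\<close>, to make
  \<open>b\<close> square-summable, and on the tails of \<open>f\<close>, to pass from polynomials
  to all of \<open>hardy2\<close>.\<close>

lemma hardy2_Riesz:
  assumes add: "\<And>f g c. f \<in> hardy2 \<Longrightarrow> g \<in> hardy2 \<Longrightarrow> L (\<lambda>z. f z + c * g z) = L f + c * L g"
    and bounded: "\<And>f. f \<in> hardy2 \<Longrightarrow> cmod (L f) \<le> C * hardy2_norm f"
  obtains h where "h \<in> hardy2" "\<And>f. f \<in> hardy2 \<Longrightarrow> L f = hardy2_inner f h"
proof -
  \<comment> \<open>The argument of \<open>L\<close> is the monomial z^k. The conjugate appears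
    because the inner product of z^k with \<open>h\<close> is the conjugate of the
    \<open>k\<close>-th coefficient of \<open>h\<close>.\<close>
  define b where "b k = cnj (L (hardy_of (\<lambda>n. if n = k then 1 else 0)))" for k
  have L_0: "L (\<lambda>z. 0) = 0"
    using add[OF zero_in_hardy2 zero_in_hardy2, of 1] by simp
  have L_finite: "L (hardy_of (\<lambda>n. if n < N then a n else 0)) = (\<Sum>n<N. a n * cnj (b n))" for a N
  proof (induction N)
    case 0
    have "hardy_of (\<lambda>n. 0) = (\<lambda>z. 0)"
      by (auto simp: hardy_of_def)
    then show ?case by (simp add: L_0)
  next
    case (Suc N)
    have "(\<lambda>n. if n < Suc N then a n else 0)
        = (\<lambda>n. (if n < N then a n else 0) + a N * (if n = N then 1 else 0))"
      by (auto simp: fun_eq_iff less_Suc_eq)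
    then show ?case
      using Suc.IH
      by (simp only: hardy_of_add_cmult[OF square_summable_finite square_summable_unit]
          add[OF hardy_of_in_hardy2[OF square_summable_finite] hardy_of_in_hardy2[OF square_summable_unit]])
         (simp add: b_def)
  qed
  have "square_summable b"
    unfolding square_summable_def
  proof (rule summableI_nonneg_bounded)
    fix N
    define S where "S = (\<Sum>n<N. (cmod (b n))\<^sup>2)"
    have "S \<ge> 0"
      unfolding S_def by (intro sum_nonneg) auto
    \<comment> \<open>On the truncation of \<open>b\<close> itself, \<open>L\<close> takes the value
      \<open>S\<close> while the norm is \<open>sqrt S\<close>; boundedness thus compares
      \<open>S\<close> with its own root.\<close>
    let ?f = "hardy_of (\<lambda>n. if n < N then b n else 0)"
    have "(\<Sum>n. (cmod (if n < N then b n else 0))\<^sup>2) = S"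
      unfolding S_def by (subst suminf_finite[of "{..<N}"]) auto
    then have "hardy2_norm ?f = sqrt S"
      by (simp add: hardy2_norm_eq[OF hardy_of_in_hardy2] square_summable_finite maclaurin_coeff_hardy_of)
    moreover have "L ?f = of_real S"
      unfolding L_finite S_def by (simp add: complex_norm_square[symmetric])
    ultimately have "S \<le> C * sqrt S"
      using bounded[OF hardy_of_in_hardy2[OF square_summable_finite], of N b] \<open>S \<ge> 0\<close> by simp
    then have "sqrt S * sqrt S \<le> C * sqrt S"
      using \<open>S \<ge> 0\<close> by simp
    \<comment> \<open>Division by \<open>sqrt S\<close> if it is nonzero; the absolute value covers
      \<open>S = 0\<close>, where \<open>C\<close> could be negative.\<close>
    then have "sqrt S \<le> \<bar>C\<bar>"
      using \<open>S \<ge> 0\<close> mult_right_le_imp_le[of "sqrt S" "sqrt S" C] by (cases "S = 0") auto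
    then show "S \<le> \<bar>C\<bar>\<^sup>2"
      by (rule sqrt_le_D)
  qed auto
  have "L f = hardy2_inner f (hardy_of b)" if f: "f \<in> hardy2" for f
  proof -
    define a where "a = maclaurin_coeff f"
    have a: "square_summable a"
      unfolding a_def using f by (rule square_summable_maclaurin_coeff)
    have f_eq: "f = hardy_of a"
      unfolding a_def using f by (simp add: hardy_of_maclaurin_coeff)
    \<comment> \<open>\<open>r N\<close> is the tail of \<open>a\<close> from index \<open>N\<close>
      on. The factor -1 gives the difference the shape required by the additivity facts.\<close>
    define r where "r N n = a n + (-1) * (if n < N then a n else 0)" for N n
    have r: "square_summable (r N)" for N
      unfolding r_def by (intro square_summable_add_cmult square_summable_finite a)
    \<comment> \<open>The truncation and the tail have disjoint supports, so their squared norms add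
      up to that of \<open>a\<close>; hence the tails tend to 0 in norm.\<close>
    have tail: "(\<Sum>n. (cmod (r N n))\<^sup>2) = (\<Sum>n. (cmod (a n))\<^sup>2) - (\<Sum>n<N. (cmod (a n))\<^sup>2)" for N
    proof -
      have "(\<lambda>n. (cmod (a n))\<^sup>2 - (if n \<in> {..<N} then (cmod (a n))\<^sup>2 else 0))
          sums ((\<Sum>n. (cmod (a n))\<^sup>2) - (\<Sum>n<N. (cmod (a n))\<^sup>2))"
        using a unfolding square_summable_def
        by (intro sums_diff summable_sums sums_If_finite_set) auto
      moreover have "(\<lambda>n. (cmod (a n))\<^sup>2 - (if n \<in> {..<N} then (cmod (a n))\<^sup>2 else 0))
          = (\<lambda>n. (cmod (r N n))\<^sup>2)"
        by (auto simp: r_def)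
      ultimately show ?thesis by (simp add: sums_iff)
    qed
    have "(\<lambda>N. \<Sum>n<N. (cmod (a n))\<^sup>2) \<longlonglongrightarrow> (\<Sum>n. (cmod (a n))\<^sup>2)"
      using a unfolding square_summable_def by (rule summable_LIMSEQ)
    from tendsto_mult_left[OF tendsto_real_sqrt[OF tendsto_diff[OF tendsto_const this]],
      of C "\<Sum>n. (cmod (a n))\<^sup>2"]
    have lim: "(\<lambda>N. C * sqrt (\<Sum>n. (cmod (r N n))\<^sup>2)) \<longlonglongrightarrow> 0"
      unfolding tail by simp
    have "cmod (L f - (\<Sum>n<N. a n * cnj (b n))) \<le> C * sqrt (\<Sum>n. (cmod (r N n))\<^sup>2)" for N
    proof -
      have "L (hardy_of (r N)) = L f - (\<Sum>n<N. a n * cnj (b n))"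
        unfolding r_def f_eq
        by (simp only: hardy_of_add_cmult[OF a square_summable_finite]
            add[OF hardy_of_in_hardy2[OF a] hardy_of_in_hardy2[OF square_summable_finite]] L_finite)
           simp
      then show ?thesis
        using bounded[OF hardy_of_in_hardy2[OF r], of N]
        by (simp add: hardy2_norm_eq[OF hardy_of_in_hardy2] r maclaurin_coeff_hardy_of)
    qed
    then have "(\<lambda>N. L f - (\<Sum>n<N. a n * cnj (b n))) \<longlonglongrightarrow> 0"
      by (intro Lim_null_comparison[OF _ lim] always_eventually allI)
    then have "(\<lambda>N. L f - (L f - (\<Sum>n<N. a n * cnj (b n)))) \<longlonglongrightarrow> L f - 0"
      by (intro tendsto_diff tendsto_const)
    then have "(\<lambda>n. a n * cnj (b n)) sums L f"
      by (simp add: sums_def)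
    then show ?thesis
      by (simp add: hardy2_inner_def maclaurin_coeff_hardy_of \<open>square_summable b\<close> a_def sums_iff)
  qed
  with hardy_of_in_hardy2[OF \<open>square_summable b\<close>] show thesis
    by (rule that)
qed

lemma hardy2_adjoint_eqI:
  assumes "h \<in> hardy2" "\<And>f. f \<in> hardy2 \<Longrightarrow> hardy2_inner (T f) g = hardy2_inner f h"
  shows "hardy2_adjoint T g = h"
  unfolding hardy2_adjoint_def
  by (rule the_equality) (use assms in \<open>auto intro!: hardy2_inner_ext\<close>)

text \<open>By Cauchy-Schwarz, the functional sending \<open>f\<close> to
  \<open>hardy2_inner (T f) g\<close> is bounded by \<open>C * hardy2_norm g\<close>. Its Riesz
  representative is the function that \<open>hardy2_adjoint\<close> describes.\<close>

lemma hardy2_adjoint_inner: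
  assumes lin: "\<And>f g c. f \<in> hardy2 \<Longrightarrow> g \<in> hardy2 \<Longrightarrow>
      T (\<lambda>z. f z + c * g z) = (\<lambda>z. T f z + c * T g z)"
    and bounded: "hardy2_bounded T" and "f \<in> hardy2" "g \<in> hardy2"
  shows "hardy2_inner (T f) g = hardy2_inner f (hardy2_adjoint T g)"
proof -
  from bounded obtain C where T: "\<And>f. f \<in> hardy2 \<Longrightarrow> T f \<in> hardy2"
    and C: "\<And>f. f \<in> hardy2 \<Longrightarrow> hardy2_norm (T f) \<le> C * hardy2_norm f"
    by (auto simp: hardy2_bounded_def)
  have "hardy2_norm g \<ge> 0"
    using \<open>g \<in> hardy2\<close> by (auto simp: hardy2_norm_eq hardy2_def intro!: suminf_nonneg)
  obtain h where h: "h \<in> hardy2" "\<And>f. f \<in> hardy2 \<Longrightarrow> hardy2_inner (T f) g = hardy2_inner f h"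
  proof (rule hardy2_Riesz[of "\<lambda>f. hardy2_inner (T f) g" "C * hardy2_norm g"])
    fix f assume f: "f \<in> hardy2"
    have "cmod (hardy2_inner (T f) g) \<le> hardy2_norm (T f) * hardy2_norm g"
      by (intro hardy2_Cauchy_Schwarz T f \<open>g \<in> hardy2\<close>)
    also have "\<dots> \<le> C * hardy2_norm f * hardy2_norm g"
      by (intro mult_right_mono C f \<open>hardy2_norm g \<ge> 0\<close>)
    finally show "cmod (hardy2_inner (T f) g) \<le> C * hardy2_norm g * hardy2_norm f"
      by (simp add: mult_ac)
  qed (auto simp: lin hardy2_inner_add_cmult_left T \<open>g \<in> hardy2\<close>)
  then have "hardy2_adjoint T g = h"
    by (intro hardy2_adjoint_eqI)
  with h \<open>f \<in> hardy2\<close> show ?thesis by simp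
qed

section \<open>Reproducing kernels\<close>

text \<open>The Szego kernel, given by its coefficients so that pairing with it becomes evaluation
  of a Maclaurin series.\<close>

definition hardy_kernel :: "complex \<Rightarrow> complex \<Rightarrow> complex" where
  "hardy_kernel w = hardy_of (\<lambda>n. cnj w ^ n)"

lemma square_summable_power:
  assumes "w \<in> unit_disc"
  shows "square_summable (\<lambda>n. w ^ n)"
proof -
  have "summable (\<lambda>n. ((cmod w)\<^sup>2) ^ n)"
    using assms by (intro summable_geometric) (simp add: abs_square_less_1)
  then show ?thesis
    by (simp add: square_summable_def norm_power power_mult[symmetric] mult.commute)
qed

text \<open>Conjugating the coefficients of the kernel gives the powers of \<open>w\<close>, so the
  inner product is the Maclaurin series of \<open>f\<close> at \<open>w\<close>. Summing the
  geometric series shows the kernel to be a reciprocal, hence nonzero on the disc.\<close>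

lemma
  assumes "w \<in> unit_disc"
  shows hardy_kernel_in_hardy2: "hardy_kernel w \<in> hardy2"
    and hardy2_inner_kernel: "f \<in> hardy2 \<Longrightarrow> hardy2_inner f (hardy_kernel w) = f w"
    and hardy_kernel_nonzero: "z \<in> unit_disc \<Longrightarrow> hardy_kernel w z \<noteq> 0"
proof -
  have ss: "square_summable (\<lambda>n. cnj w ^ n)"
    using assms by (intro square_summable_power) simp
  then show "hardy_kernel w \<in> hardy2"
    unfolding hardy_kernel_def by (rule hardy_of_in_hardy2)
  show "hardy2_inner f (hardy_kernel w) = f w" if "f \<in> hardy2"
    using maclaurin_coeff_sums[of f w] that assms
    by (simp add: hardy2_inner_def hardy_kernel_def maclaurin_coeff_hardy_of[OF ss] hardy2_def sums_iff)
  show "hardy_kernel w z \<noteq> 0" if z: "z \<in> unit_disc"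
  proof -
    have "cmod w * cmod z < 1"
      using assms z by (smt (verit) mem_ball_0 mult_left_le norm_ge_zero)
    then have lt: "cmod (cnj w * z) < 1"
      by (simp add: norm_mult)
    have "hardy_kernel w z = 1 / (1 - cnj w * z)"
      using z suminf_geometric[OF lt]
      by (simp add: hardy_kernel_def hardy_of_def power_mult_distrib)
    then show ?thesis
      using lt by auto
  qed
qed

section \<open>Zeros of the weight of a normal operator\<close>

theorem lemma2:
  fixes \<phi> \<psi> :: "complex \<Rightarrow> complex"
  assumes "\<phi> holomorphic_on unit_disc" and "\<phi> ` unit_disc \<subseteq> unit_disc"
    and "\<psi> holomorphic_on unit_disc"
    and "hardy2_bounded (weighted_comp \<psi> \<phi>)"
    and "hardy2_normal (weighted_comp \<psi> \<phi>)"
  shows "(\<forall>z\<in>unit_disc. \<psi> z = 0) \<or> (\<forall>z\<in>unit_disc. \<psi> z \<noteq> 0)"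
proof (rule disjCI)
  define T where "T = weighted_comp \<psi> \<phi>"
  \<comment> \<open>Off the disc both sides are 0 by the convention in \<open>weighted_comp\<close>,
    so this is an equality of total functions.\<close>
  have lin: "T (\<lambda>z. f z + c * g z) = (\<lambda>z. T f z + c * T g z)" for f g c
    by (auto simp: T_def weighted_comp_def algebra_simps)
  have bounded: "hardy2_bounded T" and normal: "hardy2_normal T"
    using assms by (simp_all add: T_def)
  have T_in: "T f \<in> hardy2" if "f \<in> hardy2" for f
    using bounded that by (simp add: hardy2_bounded_def)
  assume "\<not> (\<forall>z\<in>unit_disc. \<psi> z \<noteq> 0)"
  then obtain w where w: "w \<in> unit_disc" "\<psi> w = 0"
    by blast
  let ?K = "hardy_kernel w"
  have K: "?K \<in> hardy2"
    by (rule hardy_kernel_in_hardy2[OF w(1)])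
  have "hardy2_adjoint T ?K = (\<lambda>z. 0)"
  proof (rule hardy2_adjoint_eqI[OF zero_in_hardy2])
    fix f assume "f \<in> hardy2"
    then have "hardy2_inner (T f) ?K = T f w"
      by (intro hardy2_inner_kernel w T_in)
    then show "hardy2_inner (T f) ?K = hardy2_inner f (\<lambda>z. 0)"
      by (simp add: T_def weighted_comp_def w hardy2_inner_zero)
  qed
  moreover have "T (\<lambda>z. 0) = (\<lambda>z. 0)"
    by (auto simp: T_def weighted_comp_def)
  ultimately have "hardy2_adjoint T (T ?K) = (\<lambda>z. 0)"
    using bspec[OF normal[unfolded hardy2_normal_def] K] by simp
  \<comment> \<open>Moving one \<open>T\<close> across turns the squared norm of \<open>T ?K\<close>
    into the inner product of \<open>?K\<close> with \<open>hardy2_adjoint T (T ?K)\<close>, which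
    is the zero function.\<close>
  then have "hardy2_inner (T ?K) (T ?K) = 0"
    using hardy2_adjoint_inner[OF lin bounded K T_in[OF K]] by (simp add: hardy2_inner_zero)
  then have T_K: "T ?K = (\<lambda>z. 0)"
    by (rule hardy2_inner_self_eq_0[OF T_in[OF K]])
  show "\<forall>z\<in>unit_disc. \<psi> z = 0"
  proof
    fix z assume z: "z \<in> unit_disc"
    then have "\<psi> z * ?K (\<phi> z) = 0"
      using fun_cong[OF T_K, of z] by (simp add: T_def weighted_comp_def)
    \<comment> \<open>The self-map property of \<open>\<phi>\<close> enters here: off the disc the
      kernel is 0 by convention.\<close>
    moreover have "?K (\<phi> z) \<noteq> 0"
      using assms(2) z by (intro hardy_kernel_nonzero[OF w(1)]) blast
    ultimately show "\<psi> z = 0"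
      by simp
  qed
qed

end
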